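(* Let $A$ and $B$ be two abelian subalgebras of a transposed Novikov-Poisson algebra $(P,\cdot,\circ)$ over a field $\mathbf{k}$ with $\operatorname{char}\mathbf{k}\neq 2$. If $P=A+B$ (sum of subspaces, not necessarily direct), then $P$ is metatrivial.
   Context: A (left) Novikov algebra $(P,\circ)$ is a vector space with a bilinear operation satisfying $(x\circ y)\circ z=(x\circ z)\circ y$ and $(x\circ y)\circ z-x\circ(y\circ z)=(y\circ x)\circ z-y\circ(x\circ z)$ for all $x,y,z$. A transposed Novikov-Poisson algebra is a triple $(P,\cdot,\circ)$ such that $(P,\cdot)$ is a commutative associative algebra (not necessarily unital), $(P,\circ)$ is a Novikov algebra, and for all $x,y,z\in P$: $(x\cdot y)\circ z=(x\cdot z)\circ y$ and $2z\cdot(x\circ y)=(z\cdot x)\circ y+x\circ(z\cdot y)$. For subspaces $X,Y$ of $P$, $X\cdot Y$ (resp. $X\circ Y$) denotes the linear span of all $x\cdot y$ (resp. $x\circ y$), $x\in X$, $y\in Y$. A subalgebra is a linear subspace $A$ with $A\cdot A+A\circ A\subseteq A$. An algebra with two products $\cdot,\circ$ is abelian if $a\cdot b=a\circ b=0$ for all elements $a,b$. $P$ is metatrivial if there exist abelian transposed Novikov-Poisson algebras $V_1,V_2$ and an exact sequence of algebra morphisms (linear maps preserving both products) $0\to V_1\xrightarrow{i}P\xrightarrow{\pi}V_2\to 0$. *)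

theory Defs
  imports "HOL-Algebra.Algebra"
begin

text \<open>
  An algebra with two products over \<open>K\<close>: the vector space structure is that of a
  \<^locale>\<open>module\<close> over a \<^locale>\<open>field\<close>, the product written \<open>x \<cdot> y\<close> on paper is the
  inherited field \<open>mult\<close> (\<open>\<otimes>\<close>), and the product \<open>x \<circ> y\<close> is the new field \<open>circ\<close> (\<open>\<star>\<close>).
  No algebra is assumed unital: the inherited record field \<open>one\<close> is never used and carries no
  meaning.
\<close>

record ('k, 'v) two_product_algebra = "('k, 'v) module" +
  circ :: "['v, 'v] \<Rightarrow> 'v"  (infixl "\<star>\<index>" 70)

definition bilinear_op ::
  "('k, 'm) ring_scheme \<Rightarrow> ('k, 'v) two_product_algebra \<Rightarrow> ('v \<Rightarrow> 'v \<Rightarrow> 'v) \<Rightarrow> bool" where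
  "bilinear_op K P f \<longleftrightarrow>
     (\<forall>x\<in>carrier P. \<forall>y\<in>carrier P. f x y \<in> carrier P) \<and>
     (\<forall>x\<in>carrier P. \<forall>y\<in>carrier P. \<forall>z\<in>carrier P.
        f (x \<oplus>\<^bsub>P\<^esub> y) z = f x z \<oplus>\<^bsub>P\<^esub> f y z \<and>
        f z (x \<oplus>\<^bsub>P\<^esub> y) = f z x \<oplus>\<^bsub>P\<^esub> f z y) \<and>
     (\<forall>c\<in>carrier K. \<forall>x\<in>carrier P. \<forall>y\<in>carrier P.
        f (c \<odot>\<^bsub>P\<^esub> x) y = c \<odot>\<^bsub>P\<^esub> f x y \<and> f x (c \<odot>\<^bsub>P\<^esub> y) = c \<odot>\<^bsub>P\<^esub> f x y)"

locale transposed_novikov_poisson = field K + module K P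
  for K :: "('k, 'm) ring_scheme" and P :: "('k, 'v) two_product_algebra" +
  assumes dot_bilinear: "bilinear_op K P (\<lambda>x y. x \<otimes>\<^bsub>P\<^esub> y)"
    and circ_bilinear: "bilinear_op K P (\<lambda>x y. x \<star>\<^bsub>P\<^esub> y)"
    and dot_assoc: "\<lbrakk>x \<in> carrier P; y \<in> carrier P; z \<in> carrier P\<rbrakk> \<Longrightarrow>
      (x \<otimes>\<^bsub>P\<^esub> y) \<otimes>\<^bsub>P\<^esub> z = x \<otimes>\<^bsub>P\<^esub> (y \<otimes>\<^bsub>P\<^esub> z)"
    and dot_comm: "\<lbrakk>x \<in> carrier P; y \<in> carrier P\<rbrakk> \<Longrightarrow> x \<otimes>\<^bsub>P\<^esub> y = y \<otimes>\<^bsub>P\<^esub> x"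
    and circ_right_comm: "\<lbrakk>x \<in> carrier P; y \<in> carrier P; z \<in> carrier P\<rbrakk> \<Longrightarrow>
      (x \<star>\<^bsub>P\<^esub> y) \<star>\<^bsub>P\<^esub> z = (x \<star>\<^bsub>P\<^esub> z) \<star>\<^bsub>P\<^esub> y"
    and circ_left_symm: "\<lbrakk>x \<in> carrier P; y \<in> carrier P; z \<in> carrier P\<rbrakk> \<Longrightarrow>
      ((x \<star>\<^bsub>P\<^esub> y) \<star>\<^bsub>P\<^esub> z) \<ominus>\<^bsub>P\<^esub> (x \<star>\<^bsub>P\<^esub> (y \<star>\<^bsub>P\<^esub> z)) =
      ((y \<star>\<^bsub>P\<^esub> x) \<star>\<^bsub>P\<^esub> z) \<ominus>\<^bsub>P\<^esub> (y \<star>\<^bsub>P\<^esub> (x \<star>\<^bsub>P\<^esub> z))"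
    and dot_circ: "\<lbrakk>x \<in> carrier P; y \<in> carrier P; z \<in> carrier P\<rbrakk> \<Longrightarrow>
      (x \<otimes>\<^bsub>P\<^esub> y) \<star>\<^bsub>P\<^esub> z = (x \<otimes>\<^bsub>P\<^esub> z) \<star>\<^bsub>P\<^esub> y"
    and transposed_leibniz: "\<lbrakk>x \<in> carrier P; y \<in> carrier P; z \<in> carrier P\<rbrakk> \<Longrightarrow>
      [(2::nat)] \<cdot>\<^bsub>P\<^esub> (z \<otimes>\<^bsub>P\<^esub> (x \<star>\<^bsub>P\<^esub> y)) =
      ((z \<otimes>\<^bsub>P\<^esub> x) \<star>\<^bsub>P\<^esub> y) \<oplus>\<^bsub>P\<^esub> (x \<star>\<^bsub>P\<^esub> (z \<otimes>\<^bsub>P\<^esub> y))"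

definition lin_span ::
  "('k, 'm) ring_scheme \<Rightarrow> ('k, 'v) two_product_algebra \<Rightarrow> 'v set \<Rightarrow> 'v set" where
  "lin_span K P S = \<Inter>{N. submodule N K P \<and> S \<subseteq> N}"

definition dot_span ::
  "('k, 'm) ring_scheme \<Rightarrow> ('k, 'v) two_product_algebra \<Rightarrow> 'v set \<Rightarrow> 'v set \<Rightarrow> 'v set" where
  "dot_span K P S T = lin_span K P {z. \<exists>x\<in>S. \<exists>y\<in>T. z = x \<otimes>\<^bsub>P\<^esub> y}"

definition circ_span ::
  "('k, 'm) ring_scheme \<Rightarrow> ('k, 'v) two_product_algebra \<Rightarrow> 'v set \<Rightarrow> 'v set \<Rightarrow> 'v set" where
  "circ_span K P S T = lin_span K P {z. \<exists>x\<in>S. \<exists>y\<in>T. z = x \<star>\<^bsub>P\<^esub> y}"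

definition two_product_subalgebra ::
  "'v set \<Rightarrow> ('k, 'm) ring_scheme \<Rightarrow> ('k, 'v) two_product_algebra \<Rightarrow> bool" where
  "two_product_subalgebra A K P \<longleftrightarrow> submodule A K P \<and> dot_span K P A A <+>\<^bsub>P\<^esub> circ_span K P A A \<subseteq> A"

definition abelian_algebra :: "('k, 'v) two_product_algebra \<Rightarrow> bool" where
  "abelian_algebra P \<longleftrightarrow>
     (\<forall>a\<in>carrier P. \<forall>b\<in>carrier P. a \<otimes>\<^bsub>P\<^esub> b = \<zero>\<^bsub>P\<^esub> \<and> a \<star>\<^bsub>P\<^esub> b = \<zero>\<^bsub>P\<^esub>)"

definition abelian_subalgebra ::
  "'v set \<Rightarrow> ('k, 'm) ring_scheme \<Rightarrow> ('k, 'v) two_product_algebra \<Rightarrow> bool" where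
  "abelian_subalgebra A K P \<longleftrightarrow> two_product_subalgebra A K P \<and> abelian_algebra (P\<lparr>carrier := A\<rparr>)"

definition algebra_morphism ::
  "('k, 'm) ring_scheme \<Rightarrow> ('k, 'v) two_product_algebra \<Rightarrow> ('k, 'w) two_product_algebra \<Rightarrow>
   ('v \<Rightarrow> 'w) \<Rightarrow> bool" where
  "algebra_morphism K P Q f \<longleftrightarrow>
     f \<in> carrier P \<rightarrow> carrier Q \<and>
     (\<forall>x\<in>carrier P. \<forall>y\<in>carrier P. f (x \<oplus>\<^bsub>P\<^esub> y) = f x \<oplus>\<^bsub>Q\<^esub> f y) \<and>
     (\<forall>c\<in>carrier K. \<forall>x\<in>carrier P. f (c \<odot>\<^bsub>P\<^esub> x) = c \<odot>\<^bsub>Q\<^esub> f x) \<and>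
     (\<forall>x\<in>carrier P. \<forall>y\<in>carrier P. f (x \<otimes>\<^bsub>P\<^esub> y) = f x \<otimes>\<^bsub>Q\<^esub> f y) \<and>
     (\<forall>x\<in>carrier P. \<forall>y\<in>carrier P. f (x \<star>\<^bsub>P\<^esub> y) = f x \<star>\<^bsub>Q\<^esub> f y)"

text \<open>Exactness of \<open>0 \<longrightarrow> V \<longrightarrow> P \<longrightarrow> W \<longrightarrow> 0\<close> at \<open>V\<close>, \<open>P\<close> and \<open>W\<close>, in this order.\<close>

definition short_exact ::
  "('k, 'm) ring_scheme \<Rightarrow> ('k, 'u) two_product_algebra \<Rightarrow> ('u \<Rightarrow> 'v) \<Rightarrow>
   ('k, 'v) two_product_algebra \<Rightarrow> ('v \<Rightarrow> 'w) \<Rightarrow> ('k, 'w) two_product_algebra \<Rightarrow> bool" where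
  "short_exact K V i P p W \<longleftrightarrow>
     algebra_morphism K V P i \<and> algebra_morphism K P W p \<and>
     a_kernel V P i = {\<zero>\<^bsub>V\<^esub>} \<and>
     i ` carrier V = a_kernel P W p \<and>
     p ` carrier P = carrier W"

text \<open>
  HOL cannot quantify existentially over types, so \<open>V\<^sub>1\<close> ranges over the algebras whose elements
  are of the type of the elements of \<open>P\<close>, and \<open>V\<^sub>2\<close> over those whose elements are sets of such
  elements.  This loses no generality: in any exact sequence \<open>V\<^sub>1\<close> is isomorphic to the image of
  \<open>i\<close>, and \<open>V\<^sub>2\<close> to the algebra of cosets of that image.
\<close>

definition metatrivial ::
  "('k, 'm) ring_scheme \<Rightarrow> ('k, 'v) two_product_algebra \<Rightarrow> bool" where
  "metatrivial K P \<longleftrightarrow>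
     (\<exists>(V\<^sub>1 :: ('k, 'v) two_product_algebra) (V\<^sub>2 :: ('k, 'v set) two_product_algebra) i p.
        transposed_novikov_poisson K V\<^sub>1 \<and> abelian_algebra V\<^sub>1 \<and>
        transposed_novikov_poisson K V\<^sub>2 \<and> abelian_algebra V\<^sub>2 \<and>
        short_exact K V\<^sub>1 i P p V\<^sub>2)"

definition ring_char :: "('k, 'm) ring_scheme \<Rightarrow> nat" where
  "ring_char R =
     (if \<exists>n::nat. 0 < n \<and> [n] \<cdot>\<^bsub>R\<^esub> \<one>\<^bsub>R\<^esub> = \<zero>\<^bsub>R\<^esub>
      then LEAST n::nat. 0 < n \<and> [n] \<cdot>\<^bsub>R\<^esub> \<one>\<^bsub>R\<^esub> = \<zero>\<^bsub>R\<^esub> else 0)"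

end

theory Submission
  imports Defs
begin

text \<open>
  Let \<open>I\<close> be the span of all products. The quotient \<open>P / I\<close> is abelian, so it suffices that all
  products of two elements of \<open>I\<close> vanish, which can be tested on generators \<open>x \<cdot> y\<close>, \<open>x \<circ> y\<close>.
  Write \<open>a, a' \<in> A\<close> and \<open>b, b' \<in> B\<close>. Since \<open>(x \<cdot> y) \<circ> z\<close> is symmetric, \<open>(P \<cdot> P) \<circ> P = 0\<close>; then
  \<open>2 z \<cdot> (x \<circ> y) = x \<circ> (z \<cdot> y)\<close>, which, as \<open>2\<close> is invertible, gives \<open>P \<cdot> (P \<circ> P) = P \<circ> (P \<cdot> P) = 0\<close>, and
  \<open>(P \<cdot> P) \<cdot> (P \<cdot> P) = 0\<close> by associativity.
  In the Novikov algebra, \<open>(x \<circ> a) \<circ> b = 0\<close> for all \<open>x\<close> and \<open>(a \<circ> b) \<circ> b' = - b \<circ> (a \<circ> b')\<close>.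
  The first case \<open>(a \<circ> b) \<circ> (b' \<circ> a') = 0\<close> is immediate from these. For \<open>(a \<circ> b) \<circ> (a' \<circ> b')\<close>
  write \<open>a \<circ> b = \<alpha>' + \<beta>'\<close> and \<open>a' \<circ> b' = \<alpha> + \<beta>\<close>; then
  \<open>(a \<circ> b) \<circ> (a' \<circ> b') = (a \<circ> b) \<circ> \<beta> = - \<beta> \<circ> (a \<circ> b) = - \<beta> \<circ> \<alpha>' = - (a' \<circ> b') \<circ> \<alpha>' = 0\<close>.
\<close>

section \<open>Bilinear operations and linear spans\<close>

context transposed_novikov_poisson
begin

lemma submodule_lin_span:
  assumes "S \<subseteq> carrier P"
  shows "submodule (lin_span K P S) K P"
proof (rule submoduleI)
  show "lin_span K P S \<subseteq> carrier P"
    \<comment> \<open>The intersection lies in the carrier because the carrier is itself one of the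
      submodules intersected.\<close>
    using carrier_is_submodule assms unfolding lin_span_def by blast
qed (auto simp: lin_span_def dest: submoduleE subgroup.one_closed[OF submodule.axioms(1)])

lemma lin_span_superset: "S \<subseteq> lin_span K P S"
  unfolding lin_span_def by blast

lemma lin_span_minimal:
  assumes "submodule N K P" "S \<subseteq> N"
  shows "lin_span K P S \<subseteq> N"
  using assms unfolding lin_span_def by blast

lemma bilinear_null:
  assumes f: "bilinear_op K P f" and x: "x \<in> carrier P"
  shows "f \<zero>\<^bsub>P\<^esub> x = \<zero>\<^bsub>P\<^esub>" "f x \<zero>\<^bsub>P\<^esub> = \<zero>\<^bsub>P\<^esub>"
proof -
  have "f x x \<in> carrier P"
    and "f (\<zero>\<^bsub>K\<^esub> \<odot>\<^bsub>P\<^esub> x) x = \<zero>\<^bsub>K\<^esub> \<odot>\<^bsub>P\<^esub> f x x"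
    and "f x (\<zero>\<^bsub>K\<^esub> \<odot>\<^bsub>P\<^esub> x) = \<zero>\<^bsub>K\<^esub> \<odot>\<^bsub>P\<^esub> f x x"
    using f x abelian_monoid.zero_closed[of K] ring.is_abelian_group[OF ring_axioms]
    unfolding bilinear_op_def by (meson abelian_group.axioms(1))+
  then show "f \<zero>\<^bsub>P\<^esub> x = \<zero>\<^bsub>P\<^esub>" "f x \<zero>\<^bsub>P\<^esub> = \<zero>\<^bsub>P\<^esub>"
    using x by simp_all
qed

lemma minus_zero: "\<ominus>\<^bsub>P\<^esub> \<zero>\<^bsub>P\<^esub> = \<zero>\<^bsub>P\<^esub>"
  by simp

text \<open>Annihilators are the device for extending the vanishing of a product from generators to
  spans.\<close>

lemma submodule_annihilators:
  assumes f: "bilinear_op K P f" and S: "S \<subseteq> carrier P"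
  shows "submodule {u \<in> carrier P. \<forall>v\<in>S. f u v = \<zero>\<^bsub>P\<^esub>} K P"
    and "submodule {v \<in> carrier P. \<forall>u\<in>S. f u v = \<zero>\<^bsub>P\<^esub>} K P"
proof -
  have minus: "\<ominus>\<^bsub>P\<^esub> u = (\<ominus>\<^bsub>K\<^esub> \<one>\<^bsub>K\<^esub>) \<odot>\<^bsub>P\<^esub> u" if "u \<in> carrier P" for u
    using that by (simp add: smult_l_minus)
  have add: "f (u \<oplus>\<^bsub>P\<^esub> u') v = f u v \<oplus>\<^bsub>P\<^esub> f u' v" "f v (u \<oplus>\<^bsub>P\<^esub> u') = f v u \<oplus>\<^bsub>P\<^esub> f v u'"
    if "u \<in> carrier P" "u' \<in> carrier P" "v \<in> carrier P" for u u' v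
    using f that unfolding bilinear_op_def by blast+
  have smult: "f (c \<odot>\<^bsub>P\<^esub> u) v = c \<odot>\<^bsub>P\<^esub> f u v" "f u (c \<odot>\<^bsub>P\<^esub> v) = c \<odot>\<^bsub>P\<^esub> f u v"
    if "c \<in> carrier K" "u \<in> carrier P" "v \<in> carrier P" for c u v
    using f that unfolding bilinear_op_def by blast+
  have S': "v \<in> carrier P" if "v \<in> S" for v
    using S that by blast
  show "submodule {u \<in> carrier P. \<forall>v\<in>S. f u v = \<zero>\<^bsub>P\<^esub>} K P"
    by (rule submoduleI)
      (auto simp: minus add smult S' bilinear_null[OF f])
  show "submodule {v \<in> carrier P. \<forall>u\<in>S. f u v = \<zero>\<^bsub>P\<^esub>} K P"
    by (rule submoduleI)
      (auto simp: minus add smult S' bilinear_null[OF f])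
qed

text \<open>Two passes: the left annihilator of \<open>S\<close> contains \<open>S\<close>, hence
  its span; then the right annihilator of that span contains \<open>S\<close>, hence the
  span.\<close>

lemma bilinear_lin_span_eq_zero:
  assumes f: "bilinear_op K P f" and S: "S \<subseteq> carrier P"
    and eq: "\<And>u v. u \<in> S \<Longrightarrow> v \<in> S \<Longrightarrow> f u v = \<zero>\<^bsub>P\<^esub>"
    and u: "u \<in> lin_span K P S" and v: "v \<in> lin_span K P S"
  shows "f u v = \<zero>\<^bsub>P\<^esub>"
proof -
  have span: "lin_span K P S \<subseteq> carrier P"
    using submoduleE(1)[OF submodule_lin_span[OF S]] .
  have "lin_span K P S \<subseteq> {u \<in> carrier P. \<forall>v\<in>S. f u v = \<zero>\<^bsub>P\<^esub>}"
    using S eq by (intro lin_span_minimal submodule_annihilators[OF f S]) auto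
  then have "lin_span K P S \<subseteq> {v \<in> carrier P. \<forall>u\<in>lin_span K P S. f u v = \<zero>\<^bsub>P\<^esub>}"
    using S by (intro lin_span_minimal submodule_annihilators[OF f span]) auto
  then show ?thesis
    using u v by blast
qed

lemma dot_closed [simp]: "x \<in> carrier P \<Longrightarrow> y \<in> carrier P \<Longrightarrow> x \<otimes>\<^bsub>P\<^esub> y \<in> carrier P"
  and circ_closed [simp]: "x \<in> carrier P \<Longrightarrow> y \<in> carrier P \<Longrightarrow> x \<star>\<^bsub>P\<^esub> y \<in> carrier P"
  using dot_bilinear circ_bilinear unfolding bilinear_op_def by blast+

lemma dot_add:
  assumes "x \<in> carrier P" "y \<in> carrier P" "z \<in> carrier P"
  shows "(x \<oplus>\<^bsub>P\<^esub> y) \<otimes>\<^bsub>P\<^esub> z = x \<otimes>\<^bsub>P\<^esub> z \<oplus>\<^bsub>P\<^esub> y \<otimes>\<^bsub>P\<^esub> z"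
    and "z \<otimes>\<^bsub>P\<^esub> (x \<oplus>\<^bsub>P\<^esub> y) = z \<otimes>\<^bsub>P\<^esub> x \<oplus>\<^bsub>P\<^esub> z \<otimes>\<^bsub>P\<^esub> y"
  using dot_bilinear assms unfolding bilinear_op_def by blast+

lemma circ_add:
  assumes "x \<in> carrier P" "y \<in> carrier P" "z \<in> carrier P"
  shows "(x \<oplus>\<^bsub>P\<^esub> y) \<star>\<^bsub>P\<^esub> z = x \<star>\<^bsub>P\<^esub> z \<oplus>\<^bsub>P\<^esub> y \<star>\<^bsub>P\<^esub> z"
    and "z \<star>\<^bsub>P\<^esub> (x \<oplus>\<^bsub>P\<^esub> y) = z \<star>\<^bsub>P\<^esub> x \<oplus>\<^bsub>P\<^esub> z \<star>\<^bsub>P\<^esub> y"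
  using circ_bilinear assms unfolding bilinear_op_def by blast+

lemmas dot_zero [simp] = bilinear_null[OF dot_bilinear]
lemmas circ_zero [simp] = bilinear_null[OF circ_bilinear]

end


section \<open>Extensions of abelian algebras\<close>

lemma abelian_algebra_transposed_novikov_poisson:
  assumes "field K" "module K V" "abelian_algebra V"
  shows "transposed_novikov_poisson K V"
proof -
  interpret field K by fact
  interpret module K V by fact
  have [simp]: "x \<otimes>\<^bsub>V\<^esub> y = \<zero>\<^bsub>V\<^esub>" "x \<star>\<^bsub>V\<^esub> y = \<zero>\<^bsub>V\<^esub>"
    if "x \<in> carrier V" "y \<in> carrier V" for x y
    using assms(3) that unfolding abelian_algebra_def by blast+
  show ?thesis
    by unfold_locales (auto simp: bilinear_op_def)
qed

text \<open>
  Both products are declared to be zero, so this is the quotient of \<open>P\<close> by \<open>I\<close> only when \<open>I\<close>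
  contains all products of \<open>P\<close>.
\<close>

definition quotient_algebra ::
  "('k, 'v) two_product_algebra \<Rightarrow> 'v set \<Rightarrow> ('k, 'v set) two_product_algebra" where
  "quotient_algebra P I =
     \<lparr>carrier = A_RCOSETS P I, monoid.mult = (\<lambda>_ _. I), one = undefined, ring.zero = I,
      ring.add = set_add P, smult = (\<lambda>c C. \<Union>x\<in>C. I +>\<^bsub>P\<^esub> c \<odot>\<^bsub>P\<^esub> x),
      circ = (\<lambda>_ _. I)\<rparr>"

context transposed_novikov_poisson
begin

text \<open>The union defining the scalar action runs over equal cosets, because \<open>I\<close> is
  closed under scalars, so it collapses to one coset.\<close>

lemma quotient_algebra_smult:
  assumes I: "submodule I K P" and c: "c \<in> carrier K" and x: "x \<in> carrier P"
  shows "c \<odot>\<^bsub>quotient_algebra P I\<^esub> (I +>\<^bsub>P\<^esub> x) = I +>\<^bsub>P\<^esub> c \<odot>\<^bsub>P\<^esub> x"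
proof -
  interpret I: abelian_subgroup I P
    using abelian_subgroupI2[OF a_comm_group submodule.axioms(1)[OF I]] .
  have "I +>\<^bsub>P\<^esub> c \<odot>\<^bsub>P\<^esub> y = I +>\<^bsub>P\<^esub> c \<odot>\<^bsub>P\<^esub> x" if y: "y \<in> I +>\<^bsub>P\<^esub> x" for y
  proof -
    obtain h where h: "h \<in> I" "y = h \<oplus>\<^bsub>P\<^esub> x"
      using y unfolding a_r_coset_def' by blast
    have "c \<odot>\<^bsub>P\<^esub> y = c \<odot>\<^bsub>P\<^esub> h \<oplus>\<^bsub>P\<^esub> c \<odot>\<^bsub>P\<^esub> x"
      using h c x by (simp add: smult_r_distr)
    also have "\<dots> \<in> I +>\<^bsub>P\<^esub> c \<odot>\<^bsub>P\<^esub> x"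
      using submoduleE(4)[OF I c h(1)] I.a_subset c x by (simp add: M.a_rcosI)
    finally show ?thesis
      by (rule I.a_repr_independence'[symmetric]) (use c x in simp)
  qed
  moreover have "x \<in> I +>\<^bsub>P\<^esub> x"
    using I.a_rcos_self x by blast
  ultimately have "(\<Union>y\<in>I +>\<^bsub>P\<^esub> x. I +>\<^bsub>P\<^esub> c \<odot>\<^bsub>P\<^esub> y) = I +>\<^bsub>P\<^esub> c \<odot>\<^bsub>P\<^esub> x"
    by (intro UN_constant_eq ballI)
  then show ?thesis
    by (simp add: quotient_algebra_def)
qed

lemma quotient_algebra_module:
  assumes I: "submodule I K P"
  shows "module K (quotient_algebra P I)"
proof -
  interpret I: abelian_subgroup I P
    using abelian_subgroupI2[OF a_comm_group submodule.axioms(1)[OF I]] .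
  have carrier: "\<exists>x\<in>carrier P. C = I +>\<^bsub>P\<^esub> x" if "C \<in> carrier (quotient_algebra P I)" for C
    using that unfolding quotient_algebra_def A_RCOSETS_def' by auto
  have closed: "I +>\<^bsub>P\<^esub> x \<in> carrier (quotient_algebra P I)" if "x \<in> carrier P" for x
    using that unfolding quotient_algebra_def A_RCOSETS_def' by auto
  have add: "(I +>\<^bsub>P\<^esub> x) \<oplus>\<^bsub>quotient_algebra P I\<^esub> (I +>\<^bsub>P\<^esub> y) = I +>\<^bsub>P\<^esub> (x \<oplus>\<^bsub>P\<^esub> y)"
    if "x \<in> carrier P" "y \<in> carrier P" for x y
    using that by (simp add: quotient_algebra_def I.a_rcos_sum)
  have zero: "\<zero>\<^bsub>quotient_algebra P I\<^esub> = I +>\<^bsub>P\<^esub> \<zero>\<^bsub>P\<^esub>"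
    by (simp add: quotient_algebra_def I.a_rcos_const)
  note [simp] = closed add zero quotient_algebra_smult[OF I]
  show ?thesis
  proof (rule moduleI)
    show "abelian_group (quotient_algebra P I)"
    proof (rule abelian_groupI)
      fix C assume "C \<in> carrier (quotient_algebra P I)"
      then obtain x where x: "x \<in> carrier P" "C = I +>\<^bsub>P\<^esub> x"
        using carrier by blast
      then show "\<exists>D\<in>carrier (quotient_algebra P I).
          D \<oplus>\<^bsub>quotient_algebra P I\<^esub> C = \<zero>\<^bsub>quotient_algebra P I\<^esub>"
        by (intro bexI[of _ "I +>\<^bsub>P\<^esub> \<ominus>\<^bsub>P\<^esub> x"]) (simp_all add: M.l_neg)
    qed (auto dest!: carrier simp: M.a_ac)
  qed (auto dest!: carrier simp: smult_l_distr smult_r_distr smult_assoc1 is_cring)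
qed

text \<open>The exact sequence is inclusion of \<open>I\<close> followed by projection to cosets.
  \<open>products\<close> makes the projection multiplicative, and \<open>null\<close> makes
  \<open>I\<close> abelian.\<close>

lemma metatrivialI:
  assumes I: "submodule I K P"
    and products: "\<And>x y. x \<in> carrier P \<Longrightarrow> y \<in> carrier P \<Longrightarrow> x \<otimes>\<^bsub>P\<^esub> y \<in> I \<and> x \<star>\<^bsub>P\<^esub> y \<in> I"
    and null: "\<And>u v. u \<in> I \<Longrightarrow> v \<in> I \<Longrightarrow> u \<otimes>\<^bsub>P\<^esub> v = \<zero>\<^bsub>P\<^esub> \<and> u \<star>\<^bsub>P\<^esub> v = \<zero>\<^bsub>P\<^esub>"
  shows "metatrivial K P"
proof -
  interpret I: abelian_subgroup I P
    using abelian_subgroupI2[OF a_comm_group submodule.axioms(1)[OF I]] .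
  let ?V = "P\<lparr>carrier := I\<rparr>" and ?W = "quotient_algebra P I"
  have field: "field K"
    by (rule field_axioms)
  have V: "abelian_algebra ?V" and W: "abelian_algebra ?W"
    using null by (simp_all add: abelian_algebra_def quotient_algebra_def)
  have "module K ?V"
    using submodule.submodule_is_module[OF I module_axioms] .
  then have tV: "transposed_novikov_poisson K ?V"
    using abelian_algebra_transposed_novikov_poisson[OF field _ V] by blast
  have tW: "transposed_novikov_poisson K ?W"
    using abelian_algebra_transposed_novikov_poisson[OF field quotient_algebra_module[OF I] W] .
  have "algebra_morphism K ?V P (\<lambda>x. x)"
    by (simp add: algebra_morphism_def)
  moreover have "algebra_morphism K P ?W (\<lambda>x. I +>\<^bsub>P\<^esub> x)"
    unfolding algebra_morphism_def
    using quotient_algebra_smult[OF I] products I.a_rcos_sum I.a_rcos_const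
    by (auto simp: quotient_algebra_def A_RCOSETS_def')
  moreover have "a_kernel ?V P (\<lambda>x. x) = {\<zero>\<^bsub>?V\<^esub>}"
    by (auto simp: a_kernel_def')
  moreover have "(\<lambda>x. x) ` carrier ?V = a_kernel P ?W (\<lambda>x. I +>\<^bsub>P\<^esub> x)"
    using I.a_rcos_const I.a_rcos_self
    by (auto simp: a_kernel_def' quotient_algebra_def)
  moreover have "(\<lambda>x. I +>\<^bsub>P\<^esub> x) ` carrier P = carrier ?W"
    by (auto simp: quotient_algebra_def A_RCOSETS_def')
  ultimately have "short_exact K ?V (\<lambda>x. x) P (\<lambda>x. I +>\<^bsub>P\<^esub> x) ?W"
    unfolding short_exact_def by blast
  then show ?thesis
    unfolding metatrivial_def using tV tW V W by blast
qed

end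

lemma (in field) ring_char_neq_2_imp_two_neq_zero:
  assumes "ring_char R \<noteq> 2"
  shows "\<one> \<oplus> \<one> \<noteq> \<zero>"
proof
  assume "\<one> \<oplus> \<one> = \<zero>"
  then have *: "(0::nat) < 2 \<and> [(2::nat)] \<cdot> \<one> = \<zero>"
    by (simp add: numeral_2_eq_2)
  then have "(LEAST n::nat. 0 < n \<and> [n] \<cdot> \<one> = \<zero>) = 2"
  proof (rule Least_equality)
    fix n :: nat
    assume "0 < n \<and> [n] \<cdot> \<one> = \<zero>"
    then have "n \<noteq> 1" "0 < n"
      using one_not_zero by auto
    then show "2 \<le> n" by simp
  qed
  moreover have "\<exists>n::nat. 0 < n \<and> [n] \<cdot> \<one> = \<zero>"
    using * by blast
  ultimately have "ring_char R = 2"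
    unfolding ring_char_def by simp
  then show False
    using assms by blast
qed


section \<open>Sums of two abelian subalgebras\<close>

text \<open>The hypotheses are elementwise and symmetric in \<open>A\<close> and \<open>B\<close>,
  so each lemma also yields its mirror image through \<open>swap\<close>.\<close>

locale sum_of_abelian_subalgebras = transposed_novikov_poisson K P
  for K :: "('k, 'm) ring_scheme" and P :: "('k, 'v) two_product_algebra" (structure) +
  fixes A B :: "'v set"
  assumes char: "\<one>\<^bsub>K\<^esub> \<oplus>\<^bsub>K\<^esub> \<one>\<^bsub>K\<^esub> \<noteq> \<zero>\<^bsub>K\<^esub>"
    and A_carrier [simp]: "x \<in> A \<Longrightarrow> x \<in> carrier P"
    and B_carrier [simp]: "x \<in> B \<Longrightarrow> x \<in> carrier P"
    and A_null [simp]: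
      "x \<in> A \<Longrightarrow> y \<in> A \<Longrightarrow> x \<otimes> y = \<zero>" "x \<in> A \<Longrightarrow> y \<in> A \<Longrightarrow> x \<star> y = \<zero>"
    and B_null [simp]:
      "x \<in> B \<Longrightarrow> y \<in> B \<Longrightarrow> x \<otimes> y = \<zero>" "x \<in> B \<Longrightarrow> y \<in> B \<Longrightarrow> x \<star> y = \<zero>"
    and decompose: "x \<in> carrier P \<Longrightarrow> \<exists>a\<in>A. \<exists>b\<in>B. x = a \<oplus> b"
begin

lemma two_torsion_free:
  assumes x: "x \<in> carrier P" and "[(2::nat)] \<cdot> x = \<zero>"
  shows "x = \<zero>"
proof -
  let ?t = "\<one>\<^bsub>K\<^esub> \<oplus>\<^bsub>K\<^esub> \<one>\<^bsub>K\<^esub>"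
  have t: "?t \<in> Units K"
    using char field_Units by simp
  have "?t \<odot> x = \<zero>"
    using assms by (simp add: numeral_2_eq_2 smult_l_distr)
  then have "(inv\<^bsub>K\<^esub> ?t \<otimes>\<^bsub>K\<^esub> ?t) \<odot> x = \<zero>"
    \<comment> \<open>With \<open>Units_l_inv\<close> active, the scalar would become one before
      \<open>smult_assoc1\<close> could split it.\<close>
    using t x by (simp add: smult_assoc1 del: Units_l_inv)
  then show ?thesis
    using t x by simp
qed

lemma swap: "sum_of_abelian_subalgebras K P B A"
proof unfold_locales
  show "\<exists>b\<in>B. \<exists>a\<in>A. x = b \<oplus> a" if "x \<in> carrier P" for x
    using decompose[OF that] by (metis A_carrier B_carrier M.a_comm)
qed (simp_all add: char)

lemma dot_decompose:
  assumes "x \<in> carrier P" "y \<in> carrier P"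
  obtains a b a' b' where "a \<in> A" "b \<in> B" "a' \<in> A" "b' \<in> B" "x \<otimes> y = a \<otimes> b \<oplus> a' \<otimes> b'"
proof -
  obtain a b where x: "a \<in> A" "b \<in> B" "x = a \<oplus> b"
    using decompose assms by blast
  obtain a' b' where y: "a' \<in> A" "b' \<in> B" "y = a' \<oplus> b'"
    using decompose assms by blast
  have "x \<otimes> y = a \<otimes> b' \<oplus> b \<otimes> a'"
    using x y by (simp add: dot_add M.a_comm)
  also have "b \<otimes> a' = a' \<otimes> b"
    using x y by (simp add: dot_comm)
  finally show ?thesis
    using that x y by blast
qed

text \<open>Unlike for \<open>\<otimes>\<close>, both orders of the factors remain, since
  \<open>\<star>\<close> need not commute.\<close>

lemma circ_decompose:
  assumes "x \<in> carrier P" "y \<in> carrier P"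
  obtains a b a' b' where "a \<in> A" "b \<in> B" "a' \<in> A" "b' \<in> B" "x \<star> y = a \<star> b \<oplus> b' \<star> a'"
proof -
  obtain a b where x: "a \<in> A" "b \<in> B" "x = a \<oplus> b"
    using decompose assms by blast
  obtain a' b' where y: "a' \<in> A" "b' \<in> B" "y = a' \<oplus> b'"
    using decompose assms by blast
  have "x \<star> y = a \<star> b' \<oplus> b \<star> a'"
    using x y by (simp add: circ_add M.a_comm)
  then show ?thesis
    using that x y by blast
qed

section \<open>Products of products that involve \<open>\<otimes>\<close>\<close>

lemma dot_circ_eq_zero:
  assumes x: "x \<in> carrier P" and y: "y \<in> carrier P" and z: "z \<in> carrier P"
  shows "(x \<otimes> y) \<star> z = \<zero>"
proof -
  have *: "(a \<otimes> b) \<star> z = \<zero>" if ab: "a \<in> A" "b \<in> B" for a b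
  proof -
    obtain a' b' where z': "a' \<in> A" "b' \<in> B" "z = a' \<oplus> b'"
      using decompose z by blast
    \<comment> \<open>Exchanging the last two factors brings two elements of the same subalgebra
      together under \<open>\<otimes>\<close>.\<close>
    have "(a \<otimes> b) \<star> a' = (a \<otimes> a') \<star> b"
      using ab z' by (intro dot_circ) simp_all
    moreover have "(b \<otimes> a) \<star> b' = (b \<otimes> b') \<star> a"
      using ab z' by (intro dot_circ) simp_all
    moreover have "a \<otimes> b = b \<otimes> a"
      using ab by (intro dot_comm) simp_all
    ultimately show ?thesis
      using ab z' by (simp add: circ_add)
  qed
  obtain a b a' b' where "a \<in> A" "b \<in> B" "a' \<in> A" "b' \<in> B" "x \<otimes> y = a \<otimes> b \<oplus> a' \<otimes> b'"
    using dot_decompose[OF x y] by blast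
  then show ?thesis
    using z by (simp add: circ_add *)
qed

lemma two_dot_circ:
  assumes "x \<in> carrier P" "y \<in> carrier P" "z \<in> carrier P"
  shows "[(2::nat)] \<cdot> (z \<otimes> (x \<star> y)) = x \<star> (z \<otimes> y)"
  using assms by (simp add: transposed_leibniz dot_circ_eq_zero)

text \<open>For the component of \<open>z\<close> in \<open>A\<close>, \<open>two_dot_circ\<close>
  is used in both directions, with commutativity in between, to reach \<open>a \<star> a'\<close>.
  For the component in \<open>B\<close>, the inner product \<open>b' \<otimes> b\<close> already
  vanishes.\<close>

lemma dot_circ_cross_eq_zero:
  assumes z: "z \<in> carrier P" and a: "a \<in> A" and b: "b \<in> B"
  shows "z \<otimes> (a \<star> b) = \<zero>"
proof -
  obtain a' b' where z': "a' \<in> A" "b' \<in> B" "z = a' \<oplus> b'"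
    using decompose z by blast
  have "[(2::nat)] \<cdot> (a' \<otimes> (a \<star> b)) = a \<star> (a' \<otimes> b)"
    using z' a b by (simp add: two_dot_circ)
  also have "a' \<otimes> b = b \<otimes> a'"
    using z' b by (simp add: dot_comm)
  also have "a \<star> (b \<otimes> a') = [(2::nat)] \<cdot> (b \<otimes> (a \<star> a'))"
    using z' a b by (intro two_dot_circ[symmetric]) simp_all
  also have "\<dots> = \<zero>"
    using z' a b by simp
  finally have "a' \<otimes> (a \<star> b) = \<zero>"
    using z' a b by (simp add: two_torsion_free)
  moreover have "[(2::nat)] \<cdot> (b' \<otimes> (a \<star> b)) = \<zero>"
    using z' a b by (simp add: two_dot_circ)
  then have "b' \<otimes> (a \<star> b) = \<zero>"
    using z' a b by (simp add: two_torsion_free)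
  ultimately show ?thesis
    using z' a b by (simp add: dot_add)
qed

lemma dot_circ_product_eq_zero:
  assumes x: "x \<in> carrier P" and y: "y \<in> carrier P" and z: "z \<in> carrier P"
  shows "z \<otimes> (x \<star> y) = \<zero>"
proof -
  obtain a b a' b' where "a \<in> A" "b \<in> B" "a' \<in> A" "b' \<in> B" "x \<star> y = a \<star> b \<oplus> b' \<star> a'"
    using circ_decompose[OF x y] by blast
  then show ?thesis
    using z dot_circ_cross_eq_zero
      sum_of_abelian_subalgebras.dot_circ_cross_eq_zero[OF swap]
    by (simp add: dot_add)
qed

lemma circ_dot_product_eq_zero:
  assumes "x \<in> carrier P" "y \<in> carrier P" "z \<in> carrier P"
  shows "x \<star> (z \<otimes> y) = \<zero>"
  using two_dot_circ[OF assms] assms by (simp add: dot_circ_product_eq_zero)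

lemma dot_dot_eq_zero:
  assumes x: "x \<in> carrier P" and y: "y \<in> carrier P" and z: "z \<in> carrier P" and w: "w \<in> carrier P"
  shows "(x \<otimes> y) \<otimes> (z \<otimes> w) = \<zero>"
proof -
  have *: "(a \<otimes> b) \<otimes> (a' \<otimes> b') = \<zero>" if "a \<in> A" "b \<in> B" "a' \<in> A" "b' \<in> B" for a b a' b'
  proof -
    have "(a \<otimes> b) \<otimes> (a' \<otimes> b') = (b \<otimes> a) \<otimes> (a' \<otimes> b')"
      using that by (simp add: dot_comm)
    \<comment> \<open>The nullity rules are removed so that \<open>a \<otimes> a'\<close> survives
      until both sides are reassociated.\<close>
    also have "\<dots> = (b \<otimes> (a \<otimes> a')) \<otimes> b'"
      using that by (simp add: dot_assoc del: A_null B_null)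
    finally show ?thesis
      using that by simp
  qed
  obtain a b a' b' where "a \<in> A" "b \<in> B" "a' \<in> A" "b' \<in> B" "x \<otimes> y = a \<otimes> b \<oplus> a' \<otimes> b'"
    using dot_decompose[OF x y] by blast
  moreover obtain c d c' d' where "c \<in> A" "d \<in> B" "c' \<in> A" "d' \<in> B" "z \<otimes> w = c \<otimes> d \<oplus> c' \<otimes> d'"
    using dot_decompose[OF z w] by blast
  ultimately show ?thesis
    by (simp add: dot_add *)
qed

section \<open>Iterated products in the Novikov algebra\<close>

lemma circ_circ_cross_eq_zero:
  assumes x: "x \<in> carrier P" and a: "a \<in> A" and b: "b \<in> B"
  shows "(x \<star> a) \<star> b = \<zero>"
proof -
  obtain a' b' where x': "a' \<in> A" "b' \<in> B" "x = a' \<oplus> b'"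
    using decompose x by blast
  \<comment> \<open>Right commutativity handles the component of \<open>x\<close> in
    \<open>B\<close>; the one in \<open>A\<close> is killed by \<open>a\<close>.\<close>
  have "(b' \<star> a) \<star> b = (b' \<star> b) \<star> a"
    using x' a b by (intro circ_right_comm) simp_all
  then show ?thesis
    using x' a b by (simp add: circ_add)
qed

text \<open>Of the four terms of left symmetry, one contains \<open>b \<star> b'\<close> and another
  vanishes by \<open>circ_circ_cross_eq_zero\<close>.\<close>

lemma left_symm_cross:
  assumes a: "a \<in> A" and b: "b \<in> B" and b': "b' \<in> B"
  shows "(a \<star> b) \<star> b' \<oplus> b \<star> (a \<star> b') = \<zero>"
proof -
  have "(b \<star> a) \<star> b' = \<zero>"
    using circ_circ_cross_eq_zero a b b' by simp
  moreover have "a \<star> (b \<star> b') = \<zero>"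
    using a b b' by simp
  moreover have "(a \<star> b) \<star> b' \<ominus> a \<star> (b \<star> b') = (b \<star> a) \<star> b' \<ominus> b \<star> (a \<star> b')"
    using a b b' by (intro circ_left_symm) simp_all
  ultimately have "(a \<star> b) \<star> b' \<ominus> \<zero> = \<zero> \<ominus> b \<star> (a \<star> b')"
    by (simp only:)
  then have "(a \<star> b) \<star> b' = \<ominus> (b \<star> (a \<star> b'))"
    using a b b' by (simp add: a_minus_def minus_zero)
  then show ?thesis
    using a b b' by (simp add: M.l_neg)
qed

text \<open>Right commutativity turns the product into \<open>?u \<star> b\<close>, and
  \<open>?u\<close> is the negative of \<open>?v\<close>, which \<open>b\<close> kills.\<close>

lemma circ_circ_mixed_eq_zero:
  assumes a: "a \<in> A" and b: "b \<in> B" and a': "a' \<in> A" and b': "b' \<in> B"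
  shows "(a \<star> b) \<star> (b' \<star> a') = \<zero>"
proof -
  let ?u = "a \<star> (b' \<star> a')" and ?v = "(b' \<star> a) \<star> a'"
  have sum: "?v \<oplus> ?u = \<zero>"
    using sum_of_abelian_subalgebras.left_symm_cross[OF swap b' a a'] .
  have "?v \<star> b = \<zero>"
    using circ_circ_cross_eq_zero a' b a b' by simp
  then have "?u \<star> b = (?v \<oplus> ?u) \<star> b"
    using a b a' b' by (simp add: circ_add)
  also have "\<dots> = \<zero>"
    unfolding sum using b by simp
  finally show ?thesis
    using a b a' b' circ_right_comm[of a b "b' \<star> a'"] by simp
qed

lemma circ_circ_parallel_eq_zero:
  assumes a: "a \<in> A" and b: "b \<in> B" and a': "a' \<in> A" and b': "b' \<in> B"
  shows "(a \<star> b) \<star> (a' \<star> b') = \<zero>"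
proof -
  have right: "(c \<star> d) \<star> c' = \<zero>" if "c \<in> A" "d \<in> B" "c' \<in> A" for c d c'
    using that sum_of_abelian_subalgebras.circ_circ_cross_eq_zero[OF swap] by simp
  obtain \<alpha>' \<beta>' where ab: "\<alpha>' \<in> A" "\<beta>' \<in> B" "a \<star> b = \<alpha>' \<oplus> \<beta>'"
    using decompose a b by (meson A_carrier B_carrier circ_closed)
  obtain \<alpha> \<beta> where ab': "\<alpha> \<in> A" "\<beta> \<in> B" "a' \<star> b' = \<alpha> \<oplus> \<beta>"
    using decompose a' b' by (meson A_carrier B_carrier circ_closed)
  \<comment> \<open>The \<alpha> component contributes nothing here, since \<alpha> and \<alpha>'
    both lie in \<open>A\<close>.\<close>
  have "\<beta> \<star> \<alpha>' = (a' \<star> b') \<star> \<alpha>'"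
    unfolding ab' using ab ab' by (simp add: circ_add)
  also have "\<dots> = \<zero>"
    using right a' b' ab by blast
  finally have "\<beta> \<star> (a \<star> b) = \<zero>"
    unfolding ab using ab ab' by (simp add: circ_add)
  moreover have "(a \<star> \<beta>) \<star> b \<oplus> \<beta> \<star> (a \<star> b) = \<zero>"
    using left_symm_cross a b ab' by blast
  \<comment> \<open>Right commutativity identifies this with
    \<open>(a \<star> \<beta>) \<star> b\<close>.\<close>
  ultimately have "(a \<star> b) \<star> \<beta> = \<zero>"
    using a b ab' circ_right_comm[of a b \<beta>] by simp
  \<comment> \<open>The remaining summand \<open>(a \<star> b) \<star> \<alpha>\<close> is zero by
    \<open>right\<close>.\<close>
  then show ?thesis
    unfolding ab' using a b ab' right by (simp add: circ_add)
qed

lemma circ_circ_eq_zero: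
  assumes x: "x \<in> carrier P" and y: "y \<in> carrier P" and z: "z \<in> carrier P" and w: "w \<in> carrier P"
  shows "(x \<star> y) \<star> (z \<star> w) = \<zero>"
proof -
  \<comment> \<open>Of the four cross terms, those with left factor \<open>b' \<star> a'\<close> are
    the mirror images of the other two.\<close>
  note swapped =
    sum_of_abelian_subalgebras.circ_circ_mixed_eq_zero[OF swap]
    sum_of_abelian_subalgebras.circ_circ_parallel_eq_zero[OF swap]
  obtain a b a' b' where "a \<in> A" "b \<in> B" "a' \<in> A" "b' \<in> B" "x \<star> y = a \<star> b \<oplus> b' \<star> a'"
    using circ_decompose[OF x y] by blast
  moreover obtain c d c' d' where "c \<in> A" "d \<in> B" "c' \<in> A" "d' \<in> B" "z \<star> w = c \<star> d \<oplus> d' \<star> c'"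
    using circ_decompose[OF z w] by blast
  ultimately show ?thesis
    by (simp add: circ_add circ_circ_mixed_eq_zero circ_circ_parallel_eq_zero swapped)
qed

lemma metatrivial: "metatrivial K P"
proof -
  define S where
    "S = (\<lambda>(x, y). x \<otimes> y) ` (carrier P \<times> carrier P) \<union> (\<lambda>(x, y). x \<star> y) ` (carrier P \<times> carrier P)"
  have S: "S \<subseteq> carrier P"
    unfolding S_def by auto
  \<comment> \<open>Among the eight cases for generators, this one needs commutativity before an
    earlier lemma applies.\<close>
  have "(x \<star> y) \<otimes> (z \<otimes> w) = \<zero>"
    if "x \<in> carrier P" "y \<in> carrier P" "z \<in> carrier P" "w \<in> carrier P" for x y z w
    using that dot_comm[of "x \<star> y" "z \<otimes> w"] by (simp add: dot_circ_product_eq_zero)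
  then have null: "u \<otimes> v = \<zero>" "u \<star> v = \<zero>" if "u \<in> S" "v \<in> S" for u v
    using that unfolding S_def
    by (auto simp: dot_dot_eq_zero dot_circ_product_eq_zero dot_circ_eq_zero
        circ_dot_product_eq_zero circ_circ_eq_zero)
  show ?thesis
  proof (rule metatrivialI)
    show "submodule (lin_span K P S) K P"
      using submodule_lin_span[OF S] .
    show "x \<otimes> y \<in> lin_span K P S \<and> x \<star> y \<in> lin_span K P S"
      if "x \<in> carrier P" "y \<in> carrier P" for x y
      using that lin_span_superset[of S] unfolding S_def by blast
    show "u \<otimes> v = \<zero> \<and> u \<star> v = \<zero>" if "u \<in> lin_span K P S" "v \<in> lin_span K P S" for u v
      using bilinear_lin_span_eq_zero[OF dot_bilinear S null(1) that]
        bilinear_lin_span_eq_zero[OF circ_bilinear S null(2) that] by blast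
  qed
qed

end

theorem theorem4p3:
  fixes K :: "('k, 'm) ring_scheme"
    and P :: "('k, 'v) two_product_algebra"
    and A B :: "'v set"
  assumes "field K"
    and "ring_char K \<noteq> 2"
    and "transposed_novikov_poisson K P"
    and "abelian_subalgebra A K P"
    and "abelian_subalgebra B K P"
    and "carrier P = A <+>\<^bsub>P\<^esub> B"
  shows "metatrivial K P"
proof -
  interpret transposed_novikov_poisson K P by fact
  have carrier: "x \<in> carrier P" if "abelian_subalgebra C K P" "x \<in> C" for C x
    using that submoduleE(1)
    unfolding abelian_subalgebra_def two_product_subalgebra_def by blast
  have null: "x \<otimes>\<^bsub>P\<^esub> y = \<zero>\<^bsub>P\<^esub>" "x \<star>\<^bsub>P\<^esub> y = \<zero>\<^bsub>P\<^esub>"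
    if "abelian_subalgebra C K P" "x \<in> C" "y \<in> C" for C x y
    using that unfolding abelian_subalgebra_def abelian_algebra_def by simp_all
  have "sum_of_abelian_subalgebras K P A B"
  proof unfold_locales
    show "\<one>\<^bsub>K\<^esub> \<oplus>\<^bsub>K\<^esub> \<one>\<^bsub>K\<^esub> \<noteq> \<zero>\<^bsub>K\<^esub>"
      using ring_char_neq_2_imp_two_neq_zero assms(2) by blast
    show "\<exists>a\<in>A. \<exists>b\<in>B. x = a \<oplus>\<^bsub>P\<^esub> b" if "x \<in> carrier P" for x
      using that unfolding assms(6) set_add_def' by blast
  qed (fact carrier[OF assms(4)] carrier[OF assms(5)] null[OF assms(4)] null[OF assms(5)])+
  then show ?thesis
    by (rule sum_of_abelian_subalgebras.metatrivial)
qed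

end
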